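(* Let $n\ge 1$, let $\mu_n$ be any probability distribution on the Boolean cube $I_n=\{0,1\}^n$, let $y=(y_1,\dots,y_n)\in I_n$ be fixed, and let $t>0$. Then $$\int_{I_n} e^{t\left(d_H(x,y)-\mathbf{E}_{\mu_n} d_H(x,y)\right)}\,d\mu_n(x)\;\le\; e^{nt^2/2}+\sum_{k=1}^{n-1}e^{(n-k-1)t^2/2}\,E_{k},$$ where, for $1\le k\le n-1$, $$E_{k}:=e^{-t\mu^{(k+1)}(x_{k+1}\ne y_{k+1})}\,(1-e^t)\int_{I_k}a_k(x',y',t)\,\epsilon_{x',y_{k+1}}\,d\mu_k(x'),\qquad y'=(y_1,\dots,y_k).$$
   Context: $I_n=\{0,1\}^n$ and $d_H(x,y)=\sum_{i}|x_i-y_i|$ is the Hamming distance (used on $I_k$ for every $k$). Let $(x_1,\dots,x_n)$ be a random vector with distribution $\mu_n$. For $1\le k\le n$, $\mu_k$ denotes the joint distribution of $(x_1,\dots,x_k)$ on $I_k$, and $\mu^{(k)}$ denotes the distribution of the single variable $x_k$ on $\{0,1\}$; thus $\mu^{(k)}(x_k\neq y_k)$ is the marginal probability that $x_k\ne y_k$. All expectations are over $x$, with $y$ fixed. For $1\le k\le n-1$, $x'=(x_1,\dots,x_k)\in I_k$ and $y_{k+1}\in\{0,1\}$, define $\epsilon_{x',y_{k+1}}$ by $$\mu(x_{k+1}=y_{k+1}\mid x_1,\dots,x_k)=\mu^{(k+1)}(x_{k+1}=y_{k+1})+\epsilon_{x',y_{k+1}},$$ where the left side is the conditional probability under $\mu_n$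 (its value at points $x'$ with $\mu_k(x')=0$ is irrelevant). For $y'=(y_1,\dots,y_k)$, $$a_k(x',y',t):=e^{t\left(d_H(x',y')-\mathbf{E}_{\mu_k}d_H(x',y')\right)}.$$ *)

theory Defs
  imports "HOL-Probability.Probability"
begin

text \<open>
  Points of the cube are functions on the index set \<open>{1..n}\<close> with values in \<open>{0, 1}\<close>,
  extended by \<open>undefined\<close> outside it, so that projecting to the first \<open>k\<close> coordinates
  is \<open>restrict _ {1..k}\<close> and maps \<open>cube n\<close> into \<open>cube k\<close> for \<open>k \<le> n\<close>.
\<close>

definition cube :: "nat \<Rightarrow> (nat \<Rightarrow> nat) set" where
  "cube n = {1..n} \<rightarrow>\<^sub>E {0, 1}"

definition hamming :: "nat \<Rightarrow> (nat \<Rightarrow> nat) \<Rightarrow> (nat \<Rightarrow> nat) \<Rightarrow> real" where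
  "hamming k x y = (\<Sum>i = 1..k. \<bar>real (x i) - real (y i)\<bar>)"

definition joint :: "(nat \<Rightarrow> nat) pmf \<Rightarrow> nat \<Rightarrow> (nat \<Rightarrow> nat) pmf" where
  "joint \<mu> k = map_pmf (\<lambda>x. restrict x {1..k}) \<mu>"

definition marginal :: "(nat \<Rightarrow> nat) pmf \<Rightarrow> nat \<Rightarrow> nat pmf" where
  "marginal \<mu> k = map_pmf (\<lambda>x. x k) \<mu>"

text \<open>
  \<open>cond_prob\<close> is a quotient of probabilities, so it is \<open>0\<close> at points \<open>x'\<close> that are null
  for \<open>joint \<mu> k\<close>; these points do not contribute to integrals against \<open>joint \<mu> k\<close>.
\<close>

definition eps :: "(nat \<Rightarrow> nat) pmf \<Rightarrow> nat \<Rightarrow> (nat \<Rightarrow> nat) \<Rightarrow> nat \<Rightarrow> real" where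
  "eps \<mu> k x' b =
     \<P>(x in measure_pmf \<mu>. x (k + 1) = b \<bar> restrict x {1..k} = x')
     - measure_pmf.prob (marginal \<mu> (k + 1)) {z. z = b}"

definition exp_dev ::
  "(nat \<Rightarrow> nat) pmf \<Rightarrow> nat \<Rightarrow> (nat \<Rightarrow> nat) \<Rightarrow> (nat \<Rightarrow> nat) \<Rightarrow> real \<Rightarrow> real" where
  "exp_dev \<mu> k x' y' t =
     exp (t * (hamming k x' y' - measure_pmf.expectation (joint \<mu> k) (\<lambda>z. hamming k z y')))"

definition error_term :: "(nat \<Rightarrow> nat) pmf \<Rightarrow> (nat \<Rightarrow> nat) \<Rightarrow> real \<Rightarrow> nat \<Rightarrow> real" where
  "error_term \<mu> y t k =
     exp (- t * measure_pmf.prob (marginal \<mu> (k + 1)) {z. z \<noteq> y (k + 1)}) * (1 - exp t)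
     * measure_pmf.expectation (joint \<mu> k)
         (\<lambda>x'. exp_dev \<mu> k x' (restrict y {1..k}) t * eps \<mu> k x' (y (k + 1)))"

end

(* The exponential moments M k of the centred Hamming distance of the first k coordinates satisfy
   M (k + 1) <= exp (t^2 / 2) * M k + E k: conditioning on the first k coordinates and splitting
   the conditional probability as marginal plus eps, the marginal part contributes the centred
   moment generating function of a Bernoulli variable, bounded by Hoeffding's lemma, and the eps
   part contributes exactly the error term. *)

theory Submission
  imports Defs
begin

text \<open>Tower property: group the finite sum over the support by the fibres of \<open>r\<close>.
  On a fibre the weight \<open>h (r x)\<close> is constant, and the mass of \<open>P\<close> there
  is the conditional probability times the mass of the fibre.\<close>

lemma expectation_prod_cond_prob:
  fixes h :: "'b \<Rightarrow> real"
  assumes "finite (set_pmf p)"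
  shows "measure_pmf.expectation p (\<lambda>x. h (r x) * of_bool (P x))
    = measure_pmf.expectation (map_pmf r p) (\<lambda>z. h z * \<P>(x in measure_pmf p. P x \<bar> r x = z))"
proof -
  define S where "S = set_pmf p"
  have fin: "finite S" using assms by (simp add: S_def)
  have prob: "measure_pmf.prob p {x. Q x} = (\<Sum>x | x \<in> S \<and> Q x. pmf p x)" for Q
  proof -
    have "measure_pmf.prob p {x. Q x} = measure_pmf.prob p ({x. Q x} \<inter> set_pmf p)"
      by (rule measure_Int_set_pmf [symmetric])
    also have "{x. Q x} \<inter> set_pmf p = {x. x \<in> S \<and> Q x}"
      by (auto simp: S_def)
    finally show ?thesis
      using fin by (simp add: measure_measure_pmf_finite)
  qed
  have "measure_pmf.expectation p (\<lambda>x. h (r x) * of_bool (P x))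
      = (\<Sum>x\<in>S. h (r x) * of_bool (P x) * pmf p x)"
    using fin by (subst integral_measure_pmf_real[where A = S]) (auto simp: S_def)
  also have "\<dots> = (\<Sum>z\<in>r ` S. \<Sum>x | x \<in> S \<and> r x = z. h (r x) * of_bool (P x) * pmf p x)"
    by (rule sum.image_gen [OF fin])
  also have "\<dots> = (\<Sum>z\<in>r ` S. h z * \<P>(x in measure_pmf p. P x \<bar> r x = z) * pmf (map_pmf r p) z)"
  proof (rule sum.cong [OF refl])
    fix z assume "z \<in> r ` S"
    \<comment> \<open>Only fibres meeting the support occur, so the quotient defining the
      conditional probability is never a division by zero.\<close>
    then have pos: "pmf (map_pmf r p) z > 0"
      by (auto simp: S_def pmf_positive_iff)
    have eq: "pmf (map_pmf r p) z = measure_pmf.prob p {x. r x = z}"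
      by (simp add: pmf_map vimage_def)
    have "(\<Sum>x | x \<in> S \<and> r x = z. h (r x) * of_bool (P x) * pmf p x)
        = (\<Sum>x | x \<in> S \<and> r x = z. if P x then h z * pmf p x else 0)"
      by (rule sum.cong) auto
    also have "\<dots> = (\<Sum>x | x \<in> S \<and> P x \<and> r x = z. h z * pmf p x)"
      by (subst sum.inter_filter [symmetric]) (use fin in \<open>auto intro!: sum.cong\<close>)
    also have "\<dots> = h z * measure_pmf.prob p {x. P x \<and> r x = z}"
      by (simp add: prob sum_distrib_left)
    also have "\<dots> = h z * \<P>(x in measure_pmf p. P x \<bar> r x = z) * pmf (map_pmf r p) z"
      using pos unfolding eq by (simp add: cond_prob_def)
    finally show "(\<Sum>x | x \<in> S \<and> r x = z. h (r x) * of_bool (P x) * pmf p x) = \<dots>" .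
  qed
  also have "\<dots> = measure_pmf.expectation (map_pmf r p)
      (\<lambda>z. h z * \<P>(x in measure_pmf p. P x \<bar> r x = z))"
    using fin by (subst integral_measure_pmf_real[where A = "r ` S"]) (auto simp: S_def)
  finally show ?thesis .
qed

text \<open>Written as a single exponential, the left side has the exponent that Hoeffding's lemma
  bounds by t^2/8; this is then weakened to t^2/2.\<close>

lemma bernoulli_centred_mgf_le:
  fixes q t :: real
  assumes "0 \<le> q" "t > 0"
  shows "exp (- t * q) * (1 - q + q * exp t) \<le> exp (t\<^sup>2 / 2)"
proof -
  have "0 \<le> q * (exp t - 1)"
    using assms by simp
  then have pos: "1 + q * (exp t - 1) > 0"
    by linarith
  have "exp (- t * q) * (1 - q + q * exp t) = exp (- t * q + ln (1 + q * (exp t - 1)))"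
    unfolding exp_add exp_ln [OF pos] by (simp add: algebra_simps)
  also have "\<dots> \<le> exp (t\<^sup>2 / 8)"
    using Hoeffdings_lemma_aux [of t q] assms by simp
  also have "\<dots> \<le> exp (t\<^sup>2 / 2)"
    by simp
  finally show ?thesis .
qed

lemma finite_cube: "finite (cube n)"
  unfolding cube_def by (intro finite_PiE) auto

lemma hamming_restrict [simp]:
  "hamming k (restrict x {Suc 0..k}) y = hamming k x y"
  "hamming k x (restrict y {Suc 0..k}) = hamming k x y"
  by (simp_all add: hamming_def)

lemma hamming_Suc: "hamming (Suc k) x y = hamming k x y + \<bar>real (x (Suc k)) - real (y (Suc k))\<bar>"
  by (simp add: hamming_def)

text \<open>Allows all centring constants to be computed under \<open>\<mu>\<close> itself, so that
  the moments for different k live on one probability space.\<close>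

lemma expectation_joint_hamming:
  "measure_pmf.expectation (joint \<mu> k) (\<lambda>z. hamming k z y)
    = measure_pmf.expectation \<mu> (\<lambda>z. hamming k z y)"
  by (simp add: joint_def)

lemma exp_dev_restrict [simp]:
  "exp_dev \<mu> k (restrict x {Suc 0..k}) y t = exp_dev \<mu> k x y t"
  "exp_dev \<mu> k x (restrict y {Suc 0..k}) t = exp_dev \<mu> k x y t"
  by (simp_all add: exp_dev_def)

lemma cube_dist_eq:
  assumes "x \<in> cube n" "y \<in> cube n" "i \<in> {1..n}"
  shows "\<bar>real (x i) - real (y i)\<bar> = of_bool (x i \<noteq> y i)"
proof -
  have "x i \<in> {0, 1}" "y i \<in> {0, 1}"
    using assms by (auto simp: cube_def PiE_def Pi_def)
  then show ?thesis by auto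
qed

text \<open>The recursion is an exact identity, because the factor contributed by coordinate k + 1
  is affine in the indicator of agreement with \<open>y\<close>; no estimate is made yet.\<close>

lemma expectation_exp_dev_Suc:
  fixes t :: real
  assumes "k < n" and \<mu>: "set_pmf \<mu> \<subseteq> cube n" and y: "y \<in> cube n"
  defines "q \<equiv> measure_pmf.prob (marginal \<mu> (k + 1)) {z. z \<noteq> y (k + 1)}"
  shows "measure_pmf.expectation \<mu> (\<lambda>x. exp_dev \<mu> (Suc k) x y t)
    = exp (- t * q) * (1 - q + q * exp t) * measure_pmf.expectation \<mu> (\<lambda>x. exp_dev \<mu> k x y t)
      + error_term \<mu> y t k"
proof -
  let ?E = "measure_pmf.expectation \<mu>"
  let ?r = "\<lambda>x::nat \<Rightarrow> nat. restrict x {1..k}"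
  let ?a = "\<lambda>x. exp_dev \<mu> k x y t"
  let ?P = "\<lambda>x'. \<P>(x in measure_pmf \<mu>. x (k + 1) = y (k + 1) \<bar> restrict x {1..k} = x')"
  have fin: "finite (set_pmf \<mu>)"
    using \<mu> finite_cube by (rule finite_subset)
  then have fin_joint: "finite (set_pmf (joint \<mu> k))"
    by (simp add: joint_def)
  note int [simp] = integrable_measure_pmf_finite [OF fin]
    integrable_measure_pmf_finite [OF fin_joint]
  have dist: "\<bar>real (x (Suc k)) - real (y (Suc k))\<bar> = of_bool (x (Suc k) \<noteq> y (Suc k))"
    if "x \<in> set_pmf \<mu>" for x
    using that assms by (intro cube_dist_eq[where n = n]) auto
  have q: "q = measure_pmf.prob \<mu> {x. x (Suc k) \<noteq> y (Suc k)}"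
    by (simp add: q_def marginal_def vimage_def)
  \<comment> \<open>The mean distance grows by exactly \<open>q\<close>, which is the source of the
    factor \<open>exp (- t * q)\<close>.\<close>
  have "?E (\<lambda>x. \<bar>real (x (Suc k)) - real (y (Suc k))\<bar>)
      = ?E (indicator {x. x (Suc k) \<noteq> y (Suc k)})"
    by (rule integral_cong_AE) (auto simp: AE_measure_pmf_iff dist indicator_def)
  also have "\<dots> = q"
    by (simp add: q)
  finally have mean: "?E (\<lambda>x. hamming (Suc k) x y) = ?E (\<lambda>x. hamming k x y) + q"
    by (simp add: hamming_Suc)
  have compl: "measure_pmf.prob (marginal \<mu> (k + 1)) {z. z = y (k + 1)} = 1 - q"
    using measure_pmf.prob_compl[of "{z. z = y (k + 1)}" "marginal \<mu> (k + 1)"]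
    by (simp add: q_def Compl_eq_Diff_UNIV [symmetric] Compl_eq)
  have joint_E: "measure_pmf.expectation (joint \<mu> k) f = ?E (\<lambda>x. f (?r x))"
    for f :: "_ \<Rightarrow> real"
    by (simp add: joint_def)
  \<comment> \<open>With D the indicator of disagreement, e^(tD) = e^t + (1 - e^t)(1 - D). Using
    agreement rather than disagreement matches \<open>eps\<close> and produces the factor 1 - e^t of
    \<open>error_term\<close>.\<close>
  have step: "exp_dev \<mu> (Suc k) x y t
      = exp (- t * q) * (exp t * ?a x + (1 - exp t) * (?a x * of_bool (x (k + 1) = y (k + 1))))"
    if "x \<in> set_pmf \<mu>" for x
  proof -
    have "exp_dev \<mu> (Suc k) x y t
        = exp (- t * q) * ?a x * exp (t * of_bool (x (Suc k) \<noteq> y (Suc k)))"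
      unfolding exp_dev_def expectation_joint_hamming mean
      by (simp add: hamming_Suc dist [OF that] exp_add [symmetric] algebra_simps)
    then show ?thesis by (auto simp: algebra_simps)
  qed
  \<comment> \<open>\<open>?a\<close> depends on the first k coordinates only, hence is a function
    of \<open>?r x\<close>.\<close>
  have tower: "?E (\<lambda>x. ?a x * of_bool (x (k + 1) = y (k + 1)))
      = measure_pmf.expectation (joint \<mu> k) (\<lambda>x'. ?a x' * ?P x')"
    using expectation_prod_cond_prob[OF fin, of ?a ?r "\<lambda>x. x (k + 1) = y (k + 1)"]
    by (simp add: joint_def)
  have P: "?P x' = 1 - q + eps \<mu> k x' (y (k + 1))" for x'
    by (simp only: eps_def compl)
  have "?E (\<lambda>x. exp_dev \<mu> (Suc k) x y t)
      = ?E (\<lambda>x. exp (- t * q) * (exp t * ?a x 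
        + (1 - exp t) * (?a x * of_bool (x (k + 1) = y (k + 1)))))"
    by (rule integral_cong_AE) (auto simp: AE_measure_pmf_iff step)
  also have "\<dots> = exp (- t * q) * (exp t * ?E ?a
      + (1 - exp t) * ?E (\<lambda>x. ?a x * of_bool (x (k + 1) = y (k + 1))))"
    by simp
  also have "?E (\<lambda>x. ?a x * of_bool (x (k + 1) = y (k + 1)))
      = (1 - q) * ?E ?a + measure_pmf.expectation (joint \<mu> k)
          (\<lambda>x'. ?a x' * eps \<mu> k x' (y (k + 1)))"
  proof -
    have "?E (\<lambda>x. ?a x * of_bool (x (k + 1) = y (k + 1)))
      = measure_pmf.expectation (joint \<mu> k)
          (\<lambda>x'. (1 - q) * ?a x' + ?a x' * eps \<mu> k x' (y (k + 1)))"
      unfolding tower P by (simp add: algebra_simps)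
    also have "\<dots> = (1 - q) * measure_pmf.expectation (joint \<mu> k) ?a
        + measure_pmf.expectation (joint \<mu> k) (\<lambda>x'. ?a x' * eps \<mu> k x' (y (k + 1)))"
      by simp
    finally show ?thesis
      by (simp add: joint_E)
  qed
  \<comment> \<open>The coefficient of \<open>?E ?a\<close> collects to e^t + (1 - e^t)(1 - q) = 1 -
    q + q e^t.\<close>
  finally show ?thesis
    unfolding error_term_def q_def [symmetric] by (simp add: algebra_simps)
qed

lemma expectation_exp_dev_0: "measure_pmf.expectation \<mu> (\<lambda>x. exp_dev \<mu> 0 x y t) = 1"
  by (simp add: exp_dev_def hamming_def)

text \<open>Conditioning on the empty prefix is no condition, so \<open>eps\<close> vanishes. Hence
  the recursion can start at k = 0 although the sum of errors starts at k = 1.\<close>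

lemma error_term_0: "error_term \<mu> y t 0 = 0"
proof -
  have "\<P>(x in measure_pmf \<mu>. x 1 = b \<bar> restrict x {1..0} = restrict x' {1..0})
      = measure_pmf.prob \<mu> {x. x 1 = b}" for b x'
    by (simp add: cond_prob_def restrict_def)
  then have "eps \<mu> 0 (restrict x' {1..0}) b = 0" for b x'
    by (simp add: eps_def marginal_def vimage_def)
  then show ?thesis
    by (simp add: error_term_def joint_def)
qed

text \<open>Unrolled recursion: the error made in passing from k to k + 1 coordinates is multiplied
  by e^(t^2/2) in each of the m - k remaining steps up to m + 1.\<close>

lemma expectation_exp_dev_Suc_le:
  fixes t :: real
  assumes "Suc m \<le> n" "set_pmf \<mu> \<subseteq> cube n" "y \<in> cube n" "t > 0"
  shows "measure_pmf.expectation \<mu> (\<lambda>x. exp_dev \<mu> (Suc m) x y t)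
    \<le> exp (real (Suc m) * t\<^sup>2 / 2)
      + (\<Sum>k = 1..m. exp ((real m - real k) * t\<^sup>2 / 2) * error_term \<mu> y t k)"
proof -
  let ?M = "\<lambda>k. measure_pmf.expectation \<mu> (\<lambda>x. exp_dev \<mu> k x y t)"
  have rec: "?M (Suc k) \<le> exp (t\<^sup>2 / 2) * ?M k + error_term \<mu> y t k" if "k < n" for k
  proof -
    \<comment> \<open>Nonnegativity lets the Bernoulli factor be replaced by its bound; the error
      term, of either sign, is carried over unchanged.\<close>
    have "?M k \<ge> 0"
      by (simp add: exp_dev_def)
    then show ?thesis
      unfolding expectation_exp_dev_Suc [OF that assms(2,3)]
      using assms(4) by (intro add_right_mono mult_right_mono bernoulli_centred_mgf_le) auto
  qed
  show ?thesis
    using assms(1)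
  proof (induction m)
    case 0
    then show ?case
      using rec [of 0] by (simp add: expectation_exp_dev_0 error_term_0)
  next
    case (Suc m)
    let ?e = "exp (t\<^sup>2 / 2)"
    have "?M (Suc (Suc m)) \<le> ?e * ?M (Suc m) + error_term \<mu> y t (Suc m)"
      using Suc.prems by (intro rec) simp
    also have "\<dots> \<le> ?e * (exp (real (Suc m) * t\<^sup>2 / 2)
        + (\<Sum>k = 1..m. exp ((real m - real k) * t\<^sup>2 / 2) * error_term \<mu> y t k))
        + error_term \<mu> y t (Suc m)"
      using Suc by (intro add_right_mono mult_left_mono) auto
    also have "\<dots> = exp (real (Suc (Suc m)) * t\<^sup>2 / 2)
        + (\<Sum>k = 1..Suc m. exp ((real (Suc m) - real k) * t\<^sup>2 / 2) * error_term \<mu> y t k)"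
    proof -
      \<comment> \<open>Every old weight gains one factor \<open>?e\<close>, while the new summand k
        = m + 1 enters with weight e^0 = 1.\<close>
      have shift: "?e * exp (c * t\<^sup>2 / 2) = exp ((1 + c) * t\<^sup>2 / 2)" for c
        by (simp add: exp_add [symmetric] algebra_simps add_divide_distrib)
      have "?e * (\<Sum>k = 1..m. exp ((real m - real k) * t\<^sup>2 / 2) * error_term \<mu> y t k)
          = (\<Sum>k = 1..m. exp ((real (Suc m) - real k) * t\<^sup>2 / 2) * error_term \<mu> y t k)"
        unfolding sum_distrib_left
        by (intro sum.cong refl) (simp only: mult.assoc [symmetric] shift, simp add: algebra_simps)
      then show ?thesis
        by (simp add: distrib_left shift)
    qed
    finally show ?case .
  qed
qed

theorem theorem1:
  fixes n :: nat and \<mu> :: "(nat \<Rightarrow> nat) pmf" and y :: "nat \<Rightarrow> nat" and t :: real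
  assumes "n \<ge> 1"
    and "set_pmf \<mu> \<subseteq> cube n"
    and "y \<in> cube n"
    and "t > 0"
  shows "measure_pmf.expectation \<mu>
           (\<lambda>x. exp (t * (hamming n x y - measure_pmf.expectation \<mu> (\<lambda>z. hamming n z y))))
         \<le> exp (real n * t\<^sup>2 / 2)
           + (\<Sum>k = 1..n - 1. exp ((real n - real k - 1) * t\<^sup>2 / 2) * error_term \<mu> y t k)"
proof -
  \<comment> \<open>With n = m + 1 the exponent n - k - 1 becomes m - k and the sum runs to
    m.\<close>
  obtain m where n: "n = Suc m"
    using assms(1) by (cases n) auto
  show ?thesis
    using expectation_exp_dev_Suc_le [OF _ assms(2-4), of m]
    by (simp add: n exp_dev_def expectation_joint_hamming)
qed

end
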